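(* There exists a universal constant $C>0$ such that the following holds. Let $G=(V,E)$ be a finite simple graph on $n=|V|$ vertices whose diameter in the effective resistance metric is $R<\infty$. For $i\in\mathbb{N}$ let $A_i=A_i(G)\subseteq V$ be a set of minimal size such that $$V\subseteq \bigcup_{v\in A_i} B_{\mathrm{eff}}\big(v, R/2^i\big),$$ and let $\alpha_i=2^{-i}\log|A_i|$. Then $$t_{\mathrm{cov}}(G)\le C\Big(\sum_{i=1}^{\log_2\log n}\sqrt{\alpha_i}\Big)^2 R\,|E|.$$
   Context: $R_{\mathrm{eff}}(x,y)$ denotes the effective resistance between vertices $x,y$ when every edge of $G$ has unit resistance; it is a metric on $V$. For $x\in V$ and $r>0$, $B_{\mathrm{eff}}(x,r)=\{v\in V: R_{\mathrm{eff}}(x,v)\le r\}$. The cover time $t_{\mathrm{cov}}(G)$ is the maximum over starting vertices $v$ of the expected number of steps a simple random walk on $G$ started at $v$ needs to visit every vertex of $G$.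
   Formalization: The upper limit log_2 log n is read as the ceiling of log_2 ln n, raised to at least 2, since the literal bound fails for small n (for a single edge the sum is empty but the cover time is 1); V is nonempty and its vertices are natural numbers, which covers every finite graph up to isomorphism. *)

theory Defs
  imports "HOL-Analysis.Analysis"
begin

definition simple_graph :: "'a set \<Rightarrow> 'a set set \<Rightarrow> bool" where
  "simple_graph V E \<longleftrightarrow> finite V \<and> (\<forall>e\<in>E. \<exists>u v. u \<in> V \<and> v \<in> V \<and> u \<noteq> v \<and> e = {u, v})"

definition degree :: "'a set \<Rightarrow> 'a set set \<Rightarrow> 'a \<Rightarrow> nat" where
  "degree V E u = card {v \<in> V. {u, v} \<in> E}"

text \<open>Dirichlet energy of f (unit resistances); each edge counted once.\<close>
definition energy :: "'a set \<Rightarrow> 'a set set \<Rightarrow> ('a \<Rightarrow> real) \<Rightarrow> real" where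
  "energy V E f = (\<Sum>(u, v) \<in> {(u, v). u \<in> V \<and> v \<in> V \<and> {u, v} \<in> E}. (f u - f v)^2) / 2"

text \<open>Effective conductance via the Dirichlet principle.\<close>
definition eff_cond :: "'a set \<Rightarrow> 'a set set \<Rightarrow> 'a \<Rightarrow> 'a \<Rightarrow> real" where
  "eff_cond V E x y = Inf {energy V E f | f. f x = 1 \<and> f y = 0}"

text \<open>Effective resistance (meaningful when the effective conductance is positive,
  i.e. when the resistance is finite).\<close>
definition R_eff :: "'a set \<Rightarrow> 'a set set \<Rightarrow> 'a \<Rightarrow> 'a \<Rightarrow> real" where
  "R_eff V E x y = (if x = y then 0 else 1 / eff_cond V E x y)"

definition B_eff :: "'a set \<Rightarrow> 'a set set \<Rightarrow> 'a \<Rightarrow> real \<Rightarrow> 'a set" where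
  "B_eff V E x r = {v \<in> V. R_eff V E x v \<le> r}"

definition eff_diam :: "'a set \<Rightarrow> 'a set set \<Rightarrow> real" where
  "eff_diam V E = Max {R_eff V E x y | x y. x \<in> V \<and> y \<in> V}"

definition cover_num :: "'a set \<Rightarrow> 'a set set \<Rightarrow> nat \<Rightarrow> nat" where
  "cover_num V E i = Min {card A | A. A \<subseteq> V \<and>
      V \<subseteq> (\<Union>v\<in>A. B_eff V E v (eff_diam V E / 2 ^ i))}"

definition alpha :: "'a set \<Rightarrow> 'a set set \<Rightarrow> nat \<Rightarrow> real" where
  "alpha V E i = ln (real (cover_num V E i)) / 2 ^ i"

definition walks :: "'a set \<Rightarrow> 'a set set \<Rightarrow> 'a \<Rightarrow> nat \<Rightarrow> 'a list set" where
  "walks V E v t = {xs. length xs = Suc t \<and> set xs \<subseteq> V \<and> xs ! 0 = v \<and>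
      (\<forall>j<t. {xs ! j, xs ! Suc j} \<in> E)}"

definition walk_prob :: "'a set \<Rightarrow> 'a set set \<Rightarrow> 'a list \<Rightarrow> real" where
  "walk_prob V E xs = (\<Prod>j<length xs - 1. 1 / real (degree V E (xs ! j)))"

definition not_covered_prob :: "'a set \<Rightarrow> 'a set set \<Rightarrow> 'a \<Rightarrow> nat \<Rightarrow> real" where
  "not_covered_prob V E v t = (\<Sum>xs\<in>{xs \<in> walks V E v t. \<not> V \<subseteq> set xs}. walk_prob V E xs)"

text \<open>E_v[tau_cov] = sum over t of P_v(tau_cov > t) (tail-sum formula, value in [0,\<infinity>]).\<close>
definition exp_cover_time :: "'a set \<Rightarrow> 'a set set \<Rightarrow> 'a \<Rightarrow> ennreal" where
  "exp_cover_time V E v = (\<Sum>t. ennreal (not_covered_prob V E v t))"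

definition t_cov :: "'a set \<Rightarrow> 'a set set \<Rightarrow> ennreal" where
  "t_cov V E = Max (exp_cover_time V E ` V)"

end

theory Submission
  imports Defs
begin

text \<open>
  Let \<open>N\<^sub>x\<close> count the visits of the walk to \<open>x\<close> up to a fixed time. If \<open>g\<close> is the voltage that is 1
  at \<open>p\<close> and 0 at \<open>w\<close>, then for \<open>u > 1\<close> the function \<open>1 + (u - 1) g\<close>, multiplied by a factor
  \<open>s > 1\<close> per visit to \<open>p\<close> and \<open>r < 1\<close> per visit to \<open>w\<close>, is a supermartingale. With the optimal \<open>u\<close>
  this bounds the probability that \<open>N\<^sub>p / deg p \<ge> (X + d)\<^sup>2\<close> but \<open>N\<^sub>w / deg w < X\<^sup>2\<close> by
  \<open>2 exp (- d\<^sup>2 / R_eff p w)\<close>: along a chain of points, square roots of normalised visit counts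
  drop by at most about \<open>sqrt (R_eff p w * log (number of points))\<close>. Chaining from the
  starting vertex through the optimal covers \<open>A\<^sub>1, A\<^sub>2, \<dots>\<close> to all of \<open>V\<close>, every vertex is visited once
  the root has normalised count of order \<open>R (\<Sum>i. sqrt \<alpha>\<^sub>i)\<^sup>2\<close>; the levels stop at \<open>2\<^sup>i \<ge> ln n\<close>, where a
  union bound over \<open>V\<close> costs only \<open>O(sqrt R)\<close>. This is absorbed because \<open>|A\<^sub>2| \<ge> 2\<close>, by the
  triangle inequality for \<open>R_eff\<close>. The root reaches that count within
  \<open>O(R |E| (\<Sum>i. sqrt \<alpha>\<^sub>i)\<^sup>2)\<close> steps, again by a supermartingale, built from hitting times.
  Failure has probability at most one half from every start, so restarting gives the expectation.
\<close>

section \<open>Elementary calculus and series\<close>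

lemma linear_term_zero:
  fixes a b :: real
  assumes "\<And>t. 0 \<le> 2 * t * a + t\<^sup>2 * b" "b \<ge> 0"
  shows "a = 0"
proof (rule ccontr)
  assume "a \<noteq> 0"
  \<comment> \<open>The parabola is lowest at - a / b; the denominator \<open>b + 1\<close> also
    serves b = 0.\<close>
  have "0 \<le> 2 * (- a / (b + 1)) * a + (- a / (b + 1))\<^sup>2 * b" by (rule assms(1))
  also have "\<dots> = - (a\<^sup>2 * (b + 2)) / (b + 1)\<^sup>2"
    using assms(2) by (simp add: divide_simps power2_eq_square) (simp add: algebra_simps)
  also have "\<dots> < 0" using \<open>a \<noteq> 0\<close> assms(2) by (simp add: divide_simps)
  finally show False by simp
qed

text \<open>This is Tychonoff's theorem: potentials are functions on the whole type, not only on the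
  finite vertex set, so finite-dimensional compactness does not suffice.\<close>

lemma compact_unit_cube: "compact (UNIV \<rightarrow>\<^sub>E {0..1::real} :: ('a \<Rightarrow> real) set)"
proof -
  have "compactin (product_topology (\<lambda>i::'a. euclidean) UNIV) (UNIV \<rightarrow>\<^sub>E {0..1::real})"
    by (simp add: compactin_PiE)
  then show ?thesis by (simp add: euclidean_product_topology)
qed

lemma sum_half_powers: "(\<Sum>i\<le>M. (1 / 2 :: real) ^ i) \<le> 2"
proof -
  have "(\<Sum>i\<le>M. (1 / 2 :: real) ^ i) = 2 - (1 / 2) ^ M"
    by (induction M) auto
  then show ?thesis by simp
qed

lemma sum_four_fifths_powers: "(\<Sum>i\<le>M. (4 / 5 :: real) ^ i) \<le> 5"
proof -
  have "(\<Sum>i\<le>M. (4 / 5 :: real) ^ i) = 5 - 4 * (4 / 5) ^ M"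
    by (induction M) auto
  then show ?thesis by simp
qed

lemma sqrt_level_weight_le: "sqrt ((real i + 4) * ln 2 / 2 ^ i) \<le> 2 * (4 / 5) ^ i"
proof -
  \<comment> \<open>The ratio 32/25 is twice the square of 4/5, so after division by
    \<open>2 ^ i\<close> the square root decays like \<open>(4 / 5) ^ i\<close>.\<close>
  have "1 + real i * (7 / 25) \<le> (1 + 7 / 25 :: real) ^ i"
    by (rule Bernoulli_inequality) simp
  then have "real i + 4 \<le> 4 * (32 / 25) ^ i" by simp
  moreover have "ln (2::real) \<le> 1" using ln_le_minus_one[of "2::real"] by simp
  ultimately have "(real i + 4) * ln 2 \<le> 4 * (32 / 25) ^ i * 1"
    by (intro mult_mono) auto
  then have "(real i + 4) * ln 2 / 2 ^ i \<le> 4 * (32 / 25) ^ i / 2 ^ i"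
    by (simp add: divide_right_mono)
  also have "\<dots> = 4 * ((32 / 25) / 2) ^ i" by (simp only: power_divide times_divide_eq_right)
  also have "((32 / 25) / 2) ^ i = (4 / 5 :: real) ^ i * (4 / 5) ^ i"
    by (simp flip: power_mult_distrib)
  also have "4 * ((4 / 5 :: real) ^ i * (4 / 5) ^ i) = (2 * (4 / 5) ^ i)\<^sup>2"
    by (simp add: power2_eq_square)
  finally show ?thesis by (intro real_le_lsqrt) auto
qed

section \<open>Networks, the Laplacian and the Dirichlet form\<close>

text \<open>Positive conductances express that all resistances are finite, i.e. that the graph is
  connected.\<close>

locale network =
  fixes V :: "'a set" and E :: "'a set set"
  assumes graph: "simple_graph V E"
    and eff_cond_pos: "\<And>x y. \<lbrakk>x \<in> V; y \<in> V; x \<noteq> y\<rbrakk> \<Longrightarrow> eff_cond V E x y > 0"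
begin

definition nbs :: "'a \<Rightarrow> 'a set" where
  "nbs x = {y \<in> V. {x, y} \<in> E}"

definition deg :: "'a \<Rightarrow> real" where
  "deg x = real (degree V E x)"

text \<open>With \<open>f\<close> as potential this is the net current leaving \<open>x\<close>, so
  sources are positive.\<close>

definition lap :: "('a \<Rightarrow> real) \<Rightarrow> 'a \<Rightarrow> real" where
  "lap f x = (\<Sum>y\<in>nbs x. f x - f y)"

text \<open>The Dirichlet bilinear form, in the version after summation by parts: pairing with a
  potential of known current then reads off values of \<open>f\<close>.\<close>

definition dform :: "('a \<Rightarrow> real) \<Rightarrow> ('a \<Rightarrow> real) \<Rightarrow> real" where
  "dform f g = (\<Sum>x\<in>V. f x * lap g x)"

lemma finite_V: "finite V"
  using graph by (simp add: simple_graph_def)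

lemma finite_nbs: "finite (nbs x)"
  by (simp add: nbs_def finite_V)

lemma nbs_subset: "nbs x \<subseteq> V"
  by (auto simp: nbs_def)

lemma edge_cases:
  assumes "e \<in> E"
  obtains u v where "u \<in> V" "v \<in> V" "e = {u, v}"
proof -
  have "\<exists>u v. u \<in> V \<and> v \<in> V \<and> u \<noteq> v \<and> e = {u, v}"
    using graph assms by (simp add: simple_graph_def)
  then show thesis using that by metis
qed

lemma finite_E: "finite E"
proof (rule finite_subset)
  show "E \<subseteq> Pow V"
  proof
    fix e assume "e \<in> E"
    then show "e \<in> Pow V" by (rule edge_cases) simp
  qed
qed (simp add: finite_V)

lemma deg_eq_card_nbs: "deg x = real (card (nbs x))"
  by (simp add: deg_def degree_def nbs_def)

lemma sum_edges_swap:
  "(\<Sum>u\<in>V. \<Sum>v\<in>nbs u. F u v) = (\<Sum>u\<in>V. \<Sum>v\<in>nbs u. F v u)"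
  using sum.swap_restrict[OF finite_V finite_V, of F "\<lambda>u v. {u, v} \<in> E"]
  by (simp add: nbs_def insert_commute)

lemma edges_eq_Sigma: "{(u, v). u \<in> V \<and> v \<in> V \<and> {u, v} \<in> E} = Sigma V nbs"
  by (auto simp: nbs_def)

lemma energy_eq_sum: "energy V E f = (\<Sum>u\<in>V. \<Sum>v\<in>nbs u. (f u - f v)\<^sup>2) / 2"
  unfolding energy_def edges_eq_Sigma
  by (subst sum.Sigma) (auto simp: finite_V finite_nbs)

text \<open>Exchanging the ends of every edge turns the terms with \<open>f v\<close> into those
  with \<open>f u\<close>. The factor 2 arises because ordered pairs see each edge twice. Since the
  left side is symmetric, so is \<open>dform\<close>.\<close>

lemma green: "(\<Sum>u\<in>V. \<Sum>v\<in>nbs u. (f u - f v) * (g u - g v)) = 2 * dform f g"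
proof -
  have "(\<Sum>u\<in>V. \<Sum>v\<in>nbs u. (f u - f v) * (g u - g v))
      = (\<Sum>u\<in>V. \<Sum>v\<in>nbs u. f u * (g u - g v)) + (\<Sum>u\<in>V. \<Sum>v\<in>nbs u. f v * (g v - g u))"
    by (simp add: sum.distrib[symmetric] algebra_simps)
  also have "(\<Sum>u\<in>V. \<Sum>v\<in>nbs u. f v * (g v - g u)) = (\<Sum>u\<in>V. \<Sum>v\<in>nbs u. f u * (g u - g v))"
    by (rule sum_edges_swap)
  finally show ?thesis
    by (simp add: dform_def lap_def sum_distrib_left)
qed

lemma energy_eq_dform: "energy V E f = dform f f"
  using green[of f f] by (simp add: energy_eq_sum power2_eq_square)

lemma dform_commute: "dform f g = dform g f"
  using green[of f g] green[of g f] by (simp add: mult.commute)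

lemma lap_add: "lap (\<lambda>x. f x + g x) x = lap f x + lap g x"
  by (simp add: lap_def sum.distrib[symmetric] algebra_simps)

lemma lap_scale: "lap (\<lambda>x. c * f x) x = c * lap f x"
  by (simp add: lap_def sum_distrib_left algebra_simps)

lemma lap_sum: "lap (\<lambda>x. \<Sum>i\<in>I. f i x) x = (\<Sum>i\<in>I. lap (f i) x)"
  unfolding lap_def by (subst sum.swap) (simp add: sum_subtractf)

lemma lap_affine: "lap (\<lambda>x. a + c * f x) x = c * lap f x"
  by (simp add: lap_def sum_distrib_left algebra_simps)

lemma energy_perturb:
  "energy V E (\<lambda>x. f x + t * g x) = energy V E f + 2 * t * dform g f + t\<^sup>2 * energy V E g"
proof -
  have "energy V E (\<lambda>x. f x + t * g x) = dform f f + t * dform f g + t * dform g f + t\<^sup>2 * dform g g"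
    unfolding energy_eq_dform dform_def lap_add lap_scale
    by (simp add: sum.distrib[symmetric] sum_distrib_left algebra_simps power2_eq_square)
  then show ?thesis by (simp add: energy_eq_dform dform_commute[of f g])
qed

lemma energy_nonneg: "energy V E f \<ge> 0"
  unfolding energy_eq_sum by (simp add: sum_nonneg)

lemma eff_cond_le_energy:
  assumes "f x = 1" "f y = 0"
  shows "eff_cond V E x y \<le> energy V E f"
  unfolding eff_cond_def
proof (rule cInf_lower)
  show "energy V E f \<in> {energy V E f |f. f x = 1 \<and> f y = 0}" using assms by blast
  show "bdd_below {energy V E f |f. f x = 1 \<and> f y = 0}"
    by (rule bdd_belowI[of _ 0]) (auto simp: energy_nonneg)
qed

section \<open>Energy minimisers and unit-current potentials\<close>

lemma energy_clamp_le: "energy V E (\<lambda>x. max 0 (min 1 (f x))) \<le> energy V E f"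
proof -
  have "(max 0 (min 1 a) - max 0 (min 1 b))\<^sup>2 \<le> (a - b)\<^sup>2" for a b :: real
    by (rule abs_le_square_iff[THEN iffD1]) (auto simp: max_def min_def)
  then show ?thesis unfolding energy_eq_sum by (intro divide_right_mono sum_mono) auto
qed

lemma continuous_on_energy: "continuous_on A (energy V E)"
proof -
  have "continuous_on A (\<lambda>f. f x)" for x :: 'a
    by (rule continuous_on_subset[OF continuous_on_product_coordinates]) simp
  then show ?thesis
    unfolding energy_eq_sum
    by (intro continuous_on_divide continuous_on_sum continuous_on_power continuous_on_diff
        continuous_on_const) auto
qed

text \<open>Direct method: truncation to [0, 1] does not raise the energy, so the infimum over all
  functions is attained on a compact slice of the cube.\<close>

lemma energy_minimiser:
  assumes "p \<noteq> w"
  obtains g where "g p = 1" "g w = 0" "\<And>x. 0 \<le> g x" "\<And>x. g x \<le> 1"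
    "\<And>f. \<lbrakk>f p = 1; f w = 0\<rbrakk> \<Longrightarrow> energy V E g \<le> energy V E f"
proof -
  define K where "K = (UNIV \<rightarrow>\<^sub>E {0..1::real}) \<inter> ({f. f p = 1} \<inter> {f::'a \<Rightarrow> real. f w = 0})"
  have "closed ({f. f p = 1} \<inter> {f::'a \<Rightarrow> real. f w = 0})"
    by (intro closed_Int closed_Collect_eq continuous_intros
        continuous_on_product_then_coordinatewise continuous_on_id)
  then have "compact K" unfolding K_def by (intro compact_Int_closed compact_unit_cube)
  moreover have "(\<lambda>x. if x = p then 1 else 0) \<in> K" using assms by (auto simp: K_def)
  ultimately obtain g where g: "g \<in> K" "\<And>f. f \<in> K \<Longrightarrow> energy V E g \<le> energy V E f"
    using continuous_attains_inf[of K "energy V E"] continuous_on_energy by blast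
  show thesis
  proof
    show "g p = 1" "g w = 0" "0 \<le> g x" "g x \<le> 1" for x
      using g(1) by (auto simp: K_def PiE_iff)
    fix f :: "'a \<Rightarrow> real" assume f: "f p = 1" "f w = 0"
    then have "(\<lambda>x. max 0 (min 1 (f x))) \<in> K" by (auto simp: K_def)
    then show "energy V E g \<le> energy V E f" using g(2) energy_clamp_le order_trans by blast
  qed
qed

lemma sum_lap: "(\<Sum>x\<in>V. lap g x) = 0"
proof -
  have "(\<Sum>x\<in>V. lap g x) = dform (\<lambda>_. 1) g" by (simp add: dform_def)
  also have "\<dots> = dform g (\<lambda>_. 1)" by (rule dform_commute)
  finally show ?thesis by (simp add: dform_def lap_def)
qed

lemma R_eff_pos: "\<lbrakk>x \<in> V; y \<in> V; x \<noteq> y\<rbrakk> \<Longrightarrow> R_eff V E x y > 0"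
  by (simp add: R_eff_def eff_cond_pos)

text \<open>The first variation makes the minimiser harmonic off \<open>p\<close> and
  \<open>w\<close>. By the boundary values its energy is then the current out of \<open>p\<close>,
  and the current at \<open>w\<close> follows because the total current is 0.\<close>

lemma voltage:
  assumes "p \<in> V" "w \<in> V" "p \<noteq> w"
  obtains g where "g p = 1" "g w = 0" "\<And>x. 0 \<le> g x" "\<And>x. g x \<le> 1"
    "\<And>x. x \<in> V \<Longrightarrow> lap g x = (of_bool (x = p) - of_bool (x = w)) / R_eff V E p w"
proof -
  obtain g where g: "g p = 1" "g w = 0" "\<And>x. 0 \<le> g x" "\<And>x. g x \<le> 1"
    and min: "\<And>f. \<lbrakk>f p = 1; f w = 0\<rbrakk> \<Longrightarrow> energy V E g \<le> energy V E f"
    using energy_minimiser[OF \<open>p \<noteq> w\<close>] by metis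
  have cond: "eff_cond V E p w = energy V E g"
  proof (rule antisym)
    show "eff_cond V E p w \<le> energy V E g" using g by (intro eff_cond_le_energy) auto
    show "energy V E g \<le> eff_cond V E p w"
      unfolding eff_cond_def by (rule cInf_greatest) (use g min in blast)+
  qed
  have harm: "lap g x = 0" if "x \<in> V" "x \<noteq> p" "x \<noteq> w" for x
  proof -
    define e where "e = (\<lambda>y. of_bool (y = x) :: real)"
    have "0 \<le> 2 * t * dform e g + t\<^sup>2 * energy V E e" for t
      using min[of "\<lambda>y. g y + t * e y"] g that by (simp add: e_def energy_perturb)
    then have "dform e g = 0" by (rule linear_term_zero) (rule energy_nonneg)
    then show ?thesis using that finite_V by (simp add: dform_def e_def sum.remove[of V x])
  qed
  have V: "V = insert p (insert w (V - {p, w}))" using assms by auto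
  have "energy V E g = (\<Sum>x\<in>V. g x * lap g x)" by (simp add: energy_eq_dform dform_def)
  also have "\<dots> = lap g p"
    using assms finite_V g by (subst V) (simp add: harm)
  finally have p: "lap g p = 1 / R_eff V E p w"
    using cond assms by (simp add: R_eff_def)
  have "(\<Sum>x\<in>V. lap g x) = lap g p + lap g w"
    using assms finite_V by (subst V) (simp add: harm)
  then have w: "lap g w = - 1 / R_eff V E p w" using p by (simp add: sum_lap)
  show thesis
    by (rule that[of g]) (use g p w harm \<open>p \<noteq> w\<close> in \<open>auto\<close>)
qed

text \<open>A positive conductance drives a nonzero current out of \<open>p\<close>, which needs a
  neighbour to flow to.\<close>

lemma deg_pos:
  assumes "p \<in> V" "w \<in> V" "p \<noteq> w"
  shows "deg p > 0"
proof -
  obtain g where "\<And>x. x \<in> V \<Longrightarrow> lap g x = (of_bool (x = p) - of_bool (x = w)) / R_eff V E p w"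
    using voltage[OF assms] by metis
  from this[of p] have "lap g p \<noteq> 0" using R_eff_pos[OF assms] assms by simp
  then have "nbs p \<noteq> {}" by (auto simp: lap_def)
  then show ?thesis by (simp add: deg_eq_card_nbs finite_nbs card_gt_0_iff)
qed

text \<open>Rescaling the voltage to current one lets the zero potential cover the case
  \<open>p = w\<close>, so that later arguments need no case distinction.\<close>

lemma unit_flow:
  assumes "p \<in> V" "w \<in> V"
  obtains f where "f p = R_eff V E p w" "f w = 0" "\<And>x. 0 \<le> f x" "\<And>x. f x \<le> R_eff V E p w"
    "\<And>x. x \<in> V \<Longrightarrow> lap f x = of_bool (x = p) - of_bool (x = w)"
proof (cases "p = w")
  case True
  then show thesis by (intro that[of "\<lambda>_. 0"]) (auto simp: R_eff_def lap_def)
next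
  case False
  obtain g where g: "g p = 1" "g w = 0" "\<And>x. 0 \<le> g x" "\<And>x. g x \<le> 1"
    "\<And>x. x \<in> V \<Longrightarrow> lap g x = (of_bool (x = p) - of_bool (x = w)) / R_eff V E p w"
    using voltage[OF assms False] by metis
  have "R_eff V E p w > 0" using R_eff_pos assms False by blast
  then show thesis
    by (intro that[of "\<lambda>x. R_eff V E p w * g x"]) (use g in \<open>auto simp: lap_scale mult_left_le\<close>)
qed

section \<open>Reciprocity and the resistance metric\<close>

lemma dform_unit_flow:
  assumes "p \<in> V" "w \<in> V" "\<And>x. x \<in> V \<Longrightarrow> lap g x = of_bool (x = p) - of_bool (x = w)"
  shows "dform f g = f p - f w"
proof -
  have "dform f g = (\<Sum>x\<in>V. f x * of_bool (x = p)) - (\<Sum>x\<in>V. f x * of_bool (x = w))"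
    unfolding dform_def using assms(3) by (simp add: sum_subtractf[symmetric] right_diff_distrib)
  then show ?thesis using assms finite_V by (simp add: of_bool_def if_distrib sum.delta cong: if_cong)
qed

text \<open>Pair the unit-current potentials of the two directions: one order gives minus the first
  resistance exactly, the other is bounded below by minus the second.\<close>

lemma R_eff_commute:
  assumes "x \<in> V" "y \<in> V"
  shows "R_eff V E x y = R_eff V E y x"
proof -
  have "R_eff V E x y \<le> R_eff V E y x" if xy: "x \<in> V" "y \<in> V" for x y
  proof -
    obtain f where f: "f x = R_eff V E x y" "f y = 0"
        "\<And>z. z \<in> V \<Longrightarrow> lap f z = of_bool (z = x) - of_bool (z = y)"
      using unit_flow[OF xy] by metis
    obtain g where g: "\<And>x. 0 \<le> g x" "\<And>z. g z \<le> R_eff V E y x"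
        "\<And>z. z \<in> V \<Longrightarrow> lap g z = of_bool (z = y) - of_bool (z = x)"
      using unit_flow[OF xy(2,1)] by metis
    have "dform f g = f y - f x" using xy g by (intro dform_unit_flow) auto
    moreover have "dform g f = g x - g y" using xy f by (intro dform_unit_flow) auto
    ultimately show ?thesis using f(1,2) g(1)[of x] g(2)[of y] by (simp add: dform_commute[of f])
  qed
  then show ?thesis using assms by (auto intro: antisym)
qed

text \<open>Reciprocity: the drop between \<open>x\<close> and \<open>y\<close> of the unit-current potential from \<open>x\<close> to \<open>z\<close>
  equals the drop between \<open>x\<close> and \<open>z\<close> of the one from \<open>x\<close> to \<open>y\<close>, which is at most its
  oscillation \<open>R_eff x y\<close>.\<close>

lemma R_eff_triangle:
  assumes "x \<in> V" "y \<in> V" "z \<in> V"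
  shows "R_eff V E x z \<le> R_eff V E x y + R_eff V E y z"
proof -
  obtain f where f: "f x = R_eff V E x z" "f z = 0"
      "\<And>u. u \<in> V \<Longrightarrow> lap f u = of_bool (u = x) - of_bool (u = z)"
    using unit_flow[OF assms(1,3)] by metis
  have drop: "f a - f b \<le> R_eff V E a b" if ab: "a \<in> V" "b \<in> V" for a b
  proof -
    obtain g where g: "\<And>u. 0 \<le> g u" "\<And>u. g u \<le> R_eff V E a b"
        "\<And>u. u \<in> V \<Longrightarrow> lap g u = of_bool (u = a) - of_bool (u = b)"
      using unit_flow[OF ab] by metis
    have "dform f g = f a - f b" using ab g by (intro dform_unit_flow) auto
    moreover have "dform g f = g x - g z" using assms f by (intro dform_unit_flow) auto
    ultimately show ?thesis using g(1)[of z] g(2)[of x] by (simp add: dform_commute[of f])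
  qed
  show ?thesis using drop[OF assms(1,2)] drop[OF assms(2,3)] f(1,2) by simp
qed

section \<open>Degrees, edge counts and the resistance diameter\<close>

lemma sum_deg_le: "(\<Sum>x\<in>V. deg x) \<le> 2 * real (card E)"
proof -
  define ends where "ends e = {(u, v). {u, v} = e}" for e :: "'a set"
  have ends: "finite (ends e) \<and> card (ends e) \<le> 2" if "e \<in> E" for e
  proof -
    obtain u v where "e = {u, v}" using edge_cases \<open>e \<in> E\<close> by metis
    then have sub: "ends e \<subseteq> {(u, v), (v, u)}" by (auto simp: ends_def doubleton_eq_iff)
    have "card (ends e) \<le> card {(u, v), (v, u)}" using sub by (intro card_mono) auto
    also have "\<dots> \<le> 2" by (intro card_insert_le_m1) auto
    finally show ?thesis using sub finite_subset by blast
  qed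
  have "card (Sigma V nbs) \<le> card (\<Union>e\<in>E. ends e)"
  proof (rule card_mono)
    show "finite (\<Union>e\<in>E. ends e)" using ends finite_E by blast
    show "Sigma V nbs \<subseteq> (\<Union>e\<in>E. ends e)" by (auto simp: nbs_def ends_def)
  qed
  also have "\<dots> \<le> (\<Sum>e\<in>E. card (ends e))" by (rule card_UN_le[OF finite_E])
  also have "\<dots> \<le> (\<Sum>e\<in>E. 2)" using ends by (intro sum_mono) blast
  finally have "(\<Sum>x\<in>V. card (nbs x)) \<le> 2 * card E"
    by (simp add: card_SigmaI finite_V finite_nbs)
  then have "real (\<Sum>x\<in>V. card (nbs x)) \<le> real (2 * card E)" by (rule of_nat_mono)
  then show ?thesis by (simp add: deg_eq_card_nbs)
qed

lemma deg_le: "x \<in> V \<Longrightarrow> deg x \<le> 2 * real (card E)"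
  by (rule order_trans[OF member_le_sum[of x V deg] sum_deg_le]) (auto simp: deg_def finite_V)

lemma R_eff_le_diam: "\<lbrakk>x \<in> V; y \<in> V\<rbrakk> \<Longrightarrow> R_eff V E x y \<le> eff_diam V E"
proof -
  have "{R_eff V E x y |x y. x \<in> V \<and> y \<in> V} = (\<lambda>(x, y). R_eff V E x y) ` (V \<times> V)" by auto
  then show "\<lbrakk>x \<in> V; y \<in> V\<rbrakk> \<Longrightarrow> R_eff V E x y \<le> eff_diam V E"
    unfolding eff_diam_def using finite_V by (auto intro!: Max_ge)
qed

lemma eff_diam_attained:
  assumes "V \<noteq> {}"
  obtains x y where "x \<in> V" "y \<in> V" "eff_diam V E = R_eff V E x y"
proof -
  have eq: "{R_eff V E x y |x y. x \<in> V \<and> y \<in> V} = (\<lambda>(x, y). R_eff V E x y) ` (V \<times> V)" by auto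
  have "eff_diam V E \<in> (\<lambda>(x, y). R_eff V E x y) ` (V \<times> V)"
    unfolding eff_diam_def eq using finite_V assms by (intro Max_in) auto
  then show thesis using that by auto
qed

text \<open>The indicator of \<open>x\<close> is a test function of energy at most |E|. The bound
  later absorbs the rounding of the number of steps to an integer.\<close>

lemma card_E_mult_R_eff_ge:
  assumes "x \<in> V" "y \<in> V" "x \<noteq> y"
  shows "real (card E) * R_eff V E x y \<ge> 1"
proof -
  have "eff_cond V E x y \<le> energy V E (\<lambda>z. of_bool (z = x))"
    using assms by (intro eff_cond_le_energy) auto
  also have "\<dots> \<le> (\<Sum>u\<in>V. \<Sum>v\<in>nbs u. 1) / 2"
    unfolding energy_eq_sum by (intro divide_right_mono sum_mono) (auto simp: of_bool_def)
  also have "\<dots> \<le> real (card E)" using sum_deg_le by (simp add: deg_eq_card_nbs)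
  finally show ?thesis using assms eff_cond_pos[OF assms] by (simp add: R_eff_def field_simps)
qed

section \<open>Expectations over the walk and multiplicative supermartingales\<close>

text \<open>The expectation of \<open>F\<close> over the first \<open>t\<close> steps from
  \<open>v\<close>, as a finite sum instead of an integral over a path space.\<close>

definition walk_sum :: "'a \<Rightarrow> nat \<Rightarrow> ('a list \<Rightarrow> real) \<Rightarrow> real" where
  "walk_sum v t F = (\<Sum>xs\<in>walks V E v t. walk_prob V E xs * F xs)"

text \<open>The position at time \<open>t\<close> is left out: each visit is counted when the walk
  departs, matching the products over \<open>j < t\<close> below.\<close>

definition visits :: "'a \<Rightarrow> nat \<Rightarrow> 'a list \<Rightarrow> real" where
  "visits u t xs = (\<Sum>j<t. of_bool (xs ! j = u))"

lemma finite_walks: "finite (walks V E v t)"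
  by (rule finite_subset[OF _ finite_lists_length_eq[OF finite_V, of "Suc t"]])
    (auto simp: walks_def)

lemma walks_0: "v \<in> V \<Longrightarrow> walks V E v 0 = {[v]}"
  by (auto simp: walks_def length_Suc_conv)

text \<open>Decomposition at the first step; the inductions on time therefore vary the starting
  vertex.\<close>

lemma walks_Suc:
  assumes "v \<in> V"
  shows "walks V E v (Suc t) = (\<Union>y\<in>nbs v. (#) v ` walks V E y t)"
proof -
  have *: "(\<forall>j<Suc t. {(v # ys) ! j, (v # ys) ! Suc j} \<in> E)
      \<longleftrightarrow> {v, ys ! 0} \<in> E \<and> (\<forall>j<t. {ys ! j, ys ! Suc j} \<in> E)" for ys
    by (auto simp: less_Suc_eq_0_disj)
  have "xs \<in> walks V E v (Suc t) \<longleftrightarrow>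
      (\<exists>ys. xs = v # ys \<and> ys ! 0 \<in> nbs v \<and> ys \<in> walks V E (ys ! 0) t)" for xs
  proof (cases xs)
    case (Cons x ys)
    show ?thesis
    proof (cases "x = v \<and> length ys = Suc t")
      case True
      then have "ys ! 0 \<in> set ys" by simp
      then show ?thesis using assms * Cons True by (auto simp: walks_def nbs_def)
    qed (use Cons in \<open>auto simp: walks_def\<close>)
  qed (simp add: walks_def)
  moreover have "ys ! 0 = y" if "ys \<in> walks V E y t" for y ys
    using that by (simp add: walks_def)
  ultimately show ?thesis by blast
qed

lemma walk_prob_Cons:
  assumes "xs \<in> walks V E y t"
  shows "walk_prob V E (v # xs) = walk_prob V E xs / deg v"
proof -
  have "length xs = Suc t" using assms by (simp add: walks_def)
  then show ?thesis by (simp add: walk_prob_def prod.lessThan_Suc_shift deg_def del: prod.lessThan_Suc)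
qed

lemma walk_sum_0: "v \<in> V \<Longrightarrow> walk_sum v 0 F = F [v]"
  by (simp add: walk_sum_def walks_0 walk_prob_def)

lemma walk_sum_Suc:
  assumes "v \<in> V"
  shows "walk_sum v (Suc t) F = (\<Sum>y\<in>nbs v. walk_sum y t (\<lambda>xs. F (v # xs))) / deg v"
proof -
  have "walk_sum v (Suc t) F
      = (\<Sum>y\<in>nbs v. \<Sum>xs\<in>(#) v ` walks V E y t. walk_prob V E xs * F xs)"
    unfolding walk_sum_def walks_Suc[OF assms]
  proof (rule sum.UNION_disjoint)
    show "\<forall>y\<in>nbs v. finite ((#) v ` walks V E y t)" by (simp add: finite_walks)
  qed (auto simp: finite_nbs walks_def)
  also have "\<dots> = (\<Sum>y\<in>nbs v. \<Sum>xs\<in>walks V E y t. walk_prob V E (v # xs) * F (v # xs))"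
    by (simp add: sum.reindex)
  also have "\<dots> = (\<Sum>y\<in>nbs v. walk_sum y t (\<lambda>xs. F (v # xs)) / deg v)"
    by (simp add: walk_sum_def sum_divide_distrib walk_prob_Cons cong: sum.cong)
  finally show ?thesis by (simp add: sum_divide_distrib)
qed

lemma walk_prob_nonneg: "walk_prob V E xs \<ge> 0"
  by (simp add: walk_prob_def prod_nonneg)

lemma walk_sum_mono:
  assumes "\<And>xs. xs \<in> walks V E v t \<Longrightarrow> F xs \<le> G xs"
  shows "walk_sum v t F \<le> walk_sum v t G"
  unfolding walk_sum_def using assms by (intro sum_mono mult_left_mono walk_prob_nonneg)

lemma walk_sum_scale: "walk_sum v t (\<lambda>xs. c * F xs) = c * walk_sum v t F"
  by (simp add: walk_sum_def sum_distrib_left mult.left_commute)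

lemma walk_sum_add: "walk_sum v t (\<lambda>xs. F xs + G xs) = walk_sum v t F + walk_sum v t G"
  by (simp add: walk_sum_def sum.distrib distrib_left)

lemma walk_sum_sum: "walk_sum v t (\<lambda>xs. \<Sum>i\<in>I. F i xs) = (\<Sum>i\<in>I. walk_sum v t (F i))"
  unfolding walk_sum_def sum_distrib_left by (rule sum.swap)

text \<open>The link between walk and network: one step averages \<open>h\<close>, which subtracts
  the Laplacian divided by the degree.\<close>

lemma mean_nbs:
  assumes "deg x > 0"
  shows "(\<Sum>y\<in>nbs x. h y) / deg x = h x - lap h x / deg x"
  using assms by (simp add: lap_def sum_subtractf deg_eq_card_nbs field_simps)

lemma supermartingale:
  assumes "\<And>x. x \<in> V \<Longrightarrow> \<phi> x \<ge> 0"
    and step: "\<And>x. x \<in> V \<Longrightarrow> \<phi> x * ((\<Sum>y\<in>nbs x. h y) / deg x) \<le> h x"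
    and "v \<in> V"
  shows "walk_sum v t (\<lambda>xs. (\<Prod>j<t. \<phi> (xs ! j)) * h (xs ! t)) \<le> h v"
  using \<open>v \<in> V\<close>
proof (induction t arbitrary: v)
  case 0
  then show ?case by (simp add: walk_sum_0)
next
  case (Suc t)
  have "walk_sum v (Suc t) (\<lambda>xs. (\<Prod>j<Suc t. \<phi> (xs ! j)) * h (xs ! Suc t))
      = (\<Sum>y\<in>nbs v. \<phi> v * walk_sum y t (\<lambda>xs. (\<Prod>j<t. \<phi> (xs ! j)) * h (xs ! t))) / deg v"
    by (simp add: walk_sum_Suc[OF Suc.prems] prod.lessThan_Suc_shift mult.assoc walk_sum_scale
        del: prod.lessThan_Suc)
  also have "\<dots> \<le> (\<Sum>y\<in>nbs v. \<phi> v * h y) / deg v"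
    using assms(1) Suc nbs_subset
    by (intro divide_right_mono sum_mono mult_left_mono) (auto simp: deg_def)
  also have "\<dots> = \<phi> v * ((\<Sum>y\<in>nbs v. h y) / deg v)"
    by (simp add: sum_distrib_left)
  also have "\<dots> \<le> h v" by (rule step[OF Suc.prems])
  finally show ?case .
qed

lemma walk_sum_one_le: "v \<in> V \<Longrightarrow> walk_sum v t (\<lambda>_. 1) \<le> 1"
  using supermartingale[of "\<lambda>_. 1" "\<lambda>_. 1" v t]
  by (simp add: deg_eq_card_nbs divide_le_eq)

section \<open>Exponential bounds for visit counts\<close>

text \<open>Markov's inequality for the supermartingale; \<open>h \<ge> 1\<close> allows the
  terminal factor to be dropped.\<close>

lemma chernoff:
  assumes h: "\<And>x. x \<in> V \<Longrightarrow> h x \<ge> 1"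
    and step: "\<And>x. x \<in> V \<Longrightarrow> exp (a x) * ((\<Sum>y\<in>nbs x. h y) / deg x) \<le> h x"
    and Q: "\<And>xs. \<lbrakk>xs \<in> walks V E v t; Q xs\<rbrakk> \<Longrightarrow> c \<le> (\<Sum>j<t. a (xs ! j))"
    and v: "v \<in> V"
  shows "walk_sum v t (\<lambda>xs. of_bool (Q xs)) \<le> h v * exp (- c)"
proof -
  have "walk_sum v t (\<lambda>xs. of_bool (Q xs))
      \<le> walk_sum v t (\<lambda>xs. exp (- c) * ((\<Prod>j<t. exp (a (xs ! j))) * h (xs ! t)))"
  proof (rule walk_sum_mono)
    fix xs assume xs: "xs \<in> walks V E v t"
    then have "xs ! t \<in> V" by (auto simp: walks_def)
    then have ht: "h (xs ! t) \<ge> 1" by (rule h)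
    show "of_bool (Q xs) \<le> exp (- c) * ((\<Prod>j<t. exp (a (xs ! j))) * h (xs ! t))"
    proof (cases "Q xs")
      case True
      have "1 * 1 \<le> exp (- c + (\<Sum>j<t. a (xs ! j))) * h (xs ! t)"
        using Q[OF xs True] ht by (intro mult_mono) auto
      also have "\<dots> = exp (- c) * ((\<Prod>j<t. exp (a (xs ! j))) * h (xs ! t))"
        unfolding exp_add by (simp add: exp_sum)
      finally show ?thesis using True by simp
    next
      case False
      then show ?thesis using ht by (simp add: prod_nonneg)
    qed
  qed
  also have "\<dots> \<le> exp (- c) * h v"
    unfolding walk_sum_scale by (intro mult_left_mono supermartingale) (use step v in auto)
  finally show ?thesis by (simp add: mult.commute)
qed

text \<open>The weight is \<open>u = (X + d) / X\<close> at \<open>p\<close> and 1 at \<open>w\<close>; this ratio optimises the exponent,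
  which becomes exactly \<open>d\<^sup>2 / R_eff p w\<close>.\<close>

lemma visits_deviation:
  assumes "p \<in> V" "w \<in> V" "v \<in> V" and R: "R_eff V E p w \<le> \<rho>" and X: "0 < X" "0 \<le> d" "d \<le> X"
  shows "walk_sum v t (\<lambda>xs. of_bool ((X + d)\<^sup>2 * deg p \<le> visits p t xs \<and>
            visits w t xs < X\<^sup>2 * deg w)) \<le> 2 * exp (- d\<^sup>2 / \<rho>)"
proof (cases "p = w")
  case True
  have "X\<^sup>2 * deg w \<le> (X + d)\<^sup>2 * deg w" using X by (intro mult_right_mono power_mono) (auto simp: deg_def)
  then have "((X + d)\<^sup>2 * deg p \<le> visits p t xs \<and> visits w t xs < X\<^sup>2 * deg w) = False" for xs
    using True by auto
  then have "walk_sum v t (\<lambda>xs. of_bool ((X + d)\<^sup>2 * deg p \<le> visits p t xs \<and>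
            visits w t xs < X\<^sup>2 * deg w)) = 0"
    unfolding walk_sum_def by (simp only: of_bool_eq mult_zero_right sum.neutral_const)
  then show ?thesis by simp
next
  case False
  define R where "R = R_eff V E p w"
  have Rpos: "R > 0" using R_eff_pos assms False by (simp add: R_def)
  have dp: "deg p > 0" and dw: "deg w > 0" using deg_pos assms False by metis+
  obtain g where g: "g p = 1" "g w = 0" "\<And>x. 0 \<le> g x" "\<And>x. g x \<le> 1"
    "\<And>x. x \<in> V \<Longrightarrow> lap g x = (of_bool (x = p) - of_bool (x = w)) / R"
    using voltage[OF assms(1,2) False] unfolding R_def by metis
  \<comment> \<open>In terms of the ratio u, \<open>\<beta>\<close> is u - 1 and
    \<open>\<gamma>\<close> is 1 - 1/u. Divided by R times the degree, they are the relative gain of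
    the mean of \<open>h\<close> in a step from \<open>w\<close> and the relative loss in a step
    from \<open>p\<close>.\<close>
  define \<beta> where "\<beta> = d / X"
  define h where "h x = 1 + \<beta> * g x" for x
  define \<gamma> where "\<gamma> = d / (X + d)"
  define a where "a x = \<gamma> / (R * deg p) * of_bool (x = p) - \<beta> / (R * deg w) * of_bool (x = w)" for x
  have "1 + \<beta> = (X + d) / X" using X by (simp add: \<beta>_def add_divide_distrib)
  then have \<beta>: "0 \<le> \<beta>" "\<beta> \<le> 1" "\<gamma> * (1 + \<beta>) = \<beta>"
    using X by (auto simp: \<beta>_def \<gamma>_def)
  have lap_h: "lap h x = \<beta> * lap g x" for x unfolding h_def by (rule lap_affine)
  have "walk_sum v t (\<lambda>xs. of_bool ((X + d)\<^sup>2 * deg p \<le> visits p t xs \<and>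
            visits w t xs < X\<^sup>2 * deg w)) \<le> h v * exp (- (d\<^sup>2 / R))"
  proof (rule chernoff[where a = a])
    show "h x \<ge> 1" for x using g(3) \<beta> by (simp add: h_def)
    fix x assume x: "x \<in> V"
    show "exp (a x) * ((\<Sum>y\<in>nbs x. h y) / deg x) \<le> h x"
    proof -
      have "deg x > 0" using deg_pos[OF x \<open>p \<in> V\<close>] dp by metis
      then have m: "(\<Sum>y\<in>nbs x. h y) / deg x = h x - \<beta> * lap g x / deg x"
        by (simp add: mean_nbs lap_h)
      consider "x = p" | "x = w" | "x \<noteq> p" "x \<noteq> w" by blast
      then show ?thesis
      proof cases
        case 1
        define s where "s = \<gamma> / (R * deg p)"
        have "lap g x = 1 / R" using 1 x False g(5) by simp
        then have "(\<Sum>y\<in>nbs x. h y) / deg x = 1 + \<beta> - \<beta> / (R * deg p)"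
          unfolding m using 1 g(1) by (simp add: h_def)
        also have "\<dots> = (1 + \<beta>) * (1 - s)"
          unfolding s_def right_diff_distrib times_divide_eq_right
          by (simp add: \<beta>(3) mult.commute)
        also have "\<dots> \<le> (1 + \<beta>) * exp (- s)"
          using \<beta> exp_ge_add_one_self[of "- s"] by (intro mult_left_mono) auto
        finally have "exp s * ((\<Sum>y\<in>nbs x. h y) / deg x) \<le> exp s * ((1 + \<beta>) * exp (- s))"
          by (intro mult_left_mono) auto
        also have "\<dots> = 1 + \<beta>" by (simp add: exp_minus)
        finally show ?thesis using 1 False g(1) by (simp add: a_def s_def h_def)
      next
        case 2
        define s where "s = \<beta> / (R * deg w)"
        have "lap g x = - 1 / R" using 2 x False g(5) by simp
        then have "(\<Sum>y\<in>nbs x. h y) / deg x = 1 + s"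
          unfolding m using 2 g(2) by (simp add: h_def s_def)
        also have "\<dots> \<le> exp s" by (rule exp_ge_add_one_self)
        finally have "exp (- s) * ((\<Sum>y\<in>nbs x. h y) / deg x) \<le> exp (- s) * exp s"
          by (intro mult_left_mono) auto
        also have "\<dots> = 1" by (simp add: exp_minus)
        finally show ?thesis using 2 False g(2) by (simp add: a_def s_def h_def)
      next
        case 3
        then show ?thesis using m g x by (simp add: a_def)
      qed
    qed
  next
    fix xs
    assume "(X + d)\<^sup>2 * deg p \<le> visits p t xs \<and> visits w t xs < X\<^sup>2 * deg w"
    then have q: "(X + d)\<^sup>2 * deg p \<le> visits p t xs" "visits w t xs \<le> X\<^sup>2 * deg w" by auto
    have "(\<Sum>j<t. a (xs ! j)) = \<gamma> / (R * deg p) * visits p t xs - \<beta> / (R * deg w) * visits w t xs"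
      by (simp only: a_def visits_def sum_subtractf sum_distrib_left)
    also have "\<dots> \<ge> \<gamma> / (R * deg p) * ((X + d)\<^sup>2 * deg p) - \<beta> / (R * deg w) * (X\<^sup>2 * deg w)"
      using q Rpos dp dw X \<beta> by (intro diff_mono mult_left_mono) (auto simp: \<gamma>_def)
    also have "\<gamma> / (R * deg p) * ((X + d)\<^sup>2 * deg p) - \<beta> / (R * deg w) * (X\<^sup>2 * deg w)
        = (\<gamma> * (X + d)\<^sup>2 - \<beta> * X\<^sup>2) / R"
      using dp dw Rpos by (simp add: field_simps)
    \<comment> \<open>The two terms are d (X + d) and d X.\<close>
    also have "\<gamma> * (X + d)\<^sup>2 - \<beta> * X\<^sup>2 = d\<^sup>2"
      using X by (simp add: \<gamma>_def \<beta>_def power2_eq_square) (simp add: algebra_simps)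
    finally show "d\<^sup>2 / R \<le> (\<Sum>j<t. a (xs ! j))" .
  qed (fact \<open>v \<in> V\<close>)
  also have "\<dots> \<le> 2 * exp (- d\<^sup>2 / \<rho>)"
  proof (rule mult_mono)
    show "h v \<le> 2" using \<beta> g(3,4)[of v] mult_mono[of \<beta> 1 "g v" 1] by (simp add: h_def)
    have "d\<^sup>2 / \<rho> \<le> d\<^sup>2 / R" using R Rpos by (intro divide_left_mono) (auto simp: R_def)
    then show "exp (- (d\<^sup>2 / R)) \<le> exp (- d\<^sup>2 / \<rho>)" by simp
  qed auto
  finally show ?thesis .
qed

text \<open>The weight is \<open>1 + H / (2 |E| R)\<close>, where \<open>H x\<close> is the expected hitting time of \<open>v\<close>
  from \<open>x\<close>, a superposition of unit-current potentials.\<close>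

lemma visits_root:
  assumes v: "v \<in> V" and "w \<in> V" "v \<noteq> w"
  defines "R \<equiv> eff_diam V E" and "m \<equiv> real (card E)"
  shows "walk_sum v t (\<lambda>xs. of_bool (visits v t xs < X\<^sup>2 * deg v))
    \<le> exp (2 * X\<^sup>2 / R - real t / (4 * m * R))"
proof -
  have dpos: "deg x > 0" if "x \<in> V" for x using deg_pos that assms by metis
  have Rpos: "R > 0"
    using R_eff_pos[OF v \<open>w \<in> V\<close> \<open>v \<noteq> w\<close>] R_eff_le_diam[OF v \<open>w \<in> V\<close>] by (simp add: R_def)
  have mpos: "m > 0" using deg_le[OF v] dpos[OF v] by (simp add: m_def)
  have "\<exists>f. \<forall>y\<in>V. f y v = 0 \<and> (\<forall>x. 0 \<le> f y x \<and> f y x \<le> R) \<and>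
      (\<forall>x\<in>V. lap (f y) x = of_bool (x = y) - of_bool (x = v))"
  proof (intro bchoice ballI)
    fix y assume y: "y \<in> V"
    obtain f where "f v = 0" "\<And>x. 0 \<le> f x" "\<And>x. f x \<le> R_eff V E y v"
      "\<And>x. x \<in> V \<Longrightarrow> lap f x = of_bool (x = y) - of_bool (x = v)"
      using unit_flow[OF y v] by metis
    then show "\<exists>f. f v = 0 \<and> (\<forall>x. 0 \<le> f x \<and> f x \<le> R) \<and>
        (\<forall>x\<in>V. lap f x = of_bool (x = y) - of_bool (x = v))"
      using R_eff_le_diam[OF y v] by (intro exI[of _ f]) (auto simp: R_def intro: order_trans)
  qed
  then obtain f where f: "\<And>y. y \<in> V \<Longrightarrow> f y v = 0" "\<And>x y. y \<in> V \<Longrightarrow> 0 \<le> f y x"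
    "\<And>x y. y \<in> V \<Longrightarrow> f y x \<le> R"
    "\<And>x y. \<lbrakk>y \<in> V; x \<in> V\<rbrakk> \<Longrightarrow> lap (f y) x = of_bool (x = y) - of_bool (x = v)"
    by metis
  define H where "H x = (\<Sum>y\<in>V. deg y * f y x)" for x
  have H0: "H v = 0" by (simp add: H_def f)
  have Hnn: "H x \<ge> 0" for x unfolding H_def using f by (intro sum_nonneg) (auto simp: deg_def)
  have Hle: "H x \<le> 2 * m * R" for x
  proof -
    have "H x \<le> (\<Sum>y\<in>V. deg y * R)"
      unfolding H_def using f by (intro sum_mono mult_left_mono) (auto simp: deg_def)
    also have "\<dots> \<le> 2 * m * R"
      using sum_deg_le Rpos by (simp add: sum_distrib_right[symmetric] m_def)
    finally show ?thesis .
  qed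
  \<comment> \<open>Away from \<open>v\<close>, one step lowers the mean of \<open>H\<close> by
    exactly 1: these are the hitting time equations.\<close>
  have lapH: "lap H x = deg x - of_bool (x = v) * (\<Sum>y\<in>V. deg y)" if x: "x \<in> V" for x
  proof -
    have "lap H x = (\<Sum>y\<in>V. deg y * (of_bool (x = y) - of_bool (x = v)))"
      unfolding H_def lap_sum lap_scale using f x by simp
    also have "\<dots> = (\<Sum>y\<in>V. deg y * of_bool (x = y)) - (\<Sum>y\<in>V. deg y) * of_bool (x = v)"
      by (simp add: right_diff_distrib sum_subtractf sum_distrib_right)
    also have "(\<Sum>y\<in>V. deg y * of_bool (x = y)) = deg x"
      using x finite_V by (simp add: sum.remove[of V x])
    finally show ?thesis by simp
  qed
  \<comment> \<open>The weight \<open>h\<close> below lies between 1 and 2 and loses 1 / (2 m R) in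
    mean per step off \<open>v\<close>, hence at least the fraction \<open>\<kappa>\<close> of
    itself.\<close>
  define \<kappa> where "\<kappa> = 1 / (4 * m * R)"
  define h where "h x = 1 + 1 / (2 * m * R) * H x" for x
  have lap_h: "lap h x = 1 / (2 * m * R) * lap H x" for x unfolding h_def by (rule lap_affine)
  \<comment> \<open>Half of the penalty at \<open>v\<close> pays for the mean increase of
    \<open>h\<close> there, the other half dominates \<open>\<kappa>\<close>.\<close>
  define a where "a x = \<kappa> - 2 / (R * deg v) * of_bool (x = v)" for x
  have "walk_sum v t (\<lambda>xs. of_bool (visits v t xs < X\<^sup>2 * deg v))
    \<le> h v * exp (- (real t * \<kappa> - 2 * X\<^sup>2 / R))"
  proof (rule chernoff[where a = a])
    show "h x \<ge> 1" for x using Hnn Rpos mpos by (simp add: h_def)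
    fix x assume x: "x \<in> V"
    have m: "(\<Sum>y\<in>nbs x. h y) / deg x = h x - 1 / (2 * m * R) * lap H x / deg x"
      by (simp add: mean_nbs lap_h dpos x)
    show "exp (a x) * ((\<Sum>y\<in>nbs x. h y) / deg x) \<le> h x"
    proof (cases "x = v")
      case True
      have "\<kappa> \<le> 1 / (R * deg v)"
        using deg_le[OF v] dpos[OF v] Rpos mpos unfolding \<kappa>_def m_def[symmetric]
        by (simp add: divide_simps mult.commute)
      then have a: "a x \<le> - (1 / (R * deg v))" using True by (simp add: a_def)
      have "(\<Sum>y\<in>nbs x. h y) / deg x = 1 + ((\<Sum>y\<in>V. deg y) - deg v) / (2 * m) / (R * deg v)"
        unfolding m using True H0 lapH[OF x] Rpos mpos dpos[OF v] by (simp add: h_def field_simps)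
      also have "\<dots> \<le> 1 + 1 / (R * deg v)"
      proof -
        have "((\<Sum>y\<in>V. deg y) - deg v) / (2 * m) \<le> 1"
          using sum_deg_le dpos[OF v] mpos by (simp add: m_def)
        then show ?thesis
          using divide_right_mono[of _ 1 "R * deg v"] Rpos dpos[OF v] by fastforce
      qed
      also have "\<dots> \<le> exp (1 / (R * deg v))" by (rule exp_ge_add_one_self)
      finally have "exp (a x) * ((\<Sum>y\<in>nbs x. h y) / deg x)
          \<le> exp (- (1 / (R * deg v))) * exp (1 / (R * deg v))"
        using a by (intro mult_mono) (auto simp: h_def deg_def Hnn Rpos less_imp_le mpos intro!: divide_nonneg_nonneg sum_nonneg add_nonneg_nonneg)
      also have "\<dots> = h x" using True H0 by (simp add: h_def exp_minus)
      finally show ?thesis .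
    next
      case False
      have "h x \<le> 2" using Hle[of x] Rpos mpos by (simp add: h_def)
      then have "(\<Sum>y\<in>nbs x. h y) / deg x \<le> h x * (1 - \<kappa>)"
        unfolding m lapH[OF x] using False dpos[OF x] Rpos mpos by (simp add: \<kappa>_def field_simps)
      also have "\<dots> \<le> h x * exp (- \<kappa>)"
        using exp_ge_add_one_self[of "- \<kappa>"] Hnn Rpos mpos by (intro mult_left_mono) (auto simp: h_def)
      finally have "exp \<kappa> * ((\<Sum>y\<in>nbs x. h y) / deg x) \<le> exp \<kappa> * (h x * exp (- \<kappa>))"
        by (intro mult_left_mono) auto
      also have "\<dots> = h x" by (simp add: exp_minus)
      finally show ?thesis using False by (simp add: a_def)
    qed
  next
    fix xs assume "visits v t xs < X\<^sup>2 * deg v"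
    then have "2 / (R * deg v) * visits v t xs \<le> 2 / (R * deg v) * (X\<^sup>2 * deg v)"
      using Rpos dpos[OF v] by (intro mult_left_mono) auto
    also have "\<dots> = 2 * X\<^sup>2 / R" using dpos[OF v] by simp
    moreover have "(\<Sum>j<t. a (xs ! j)) = real t * \<kappa> - 2 / (R * deg v) * visits v t xs"
      unfolding a_def visits_def sum_subtractf sum_distrib_left
      by (simp only: sum_constant card_lessThan)
    ultimately show "real t * \<kappa> - 2 * X\<^sup>2 / R \<le> (\<Sum>j<t. a (xs ! j))" by simp
  qed (fact v)
  then show ?thesis by (simp add: h_def H0 \<kappa>_def)
qed

section \<open>Covering probabilities, restarts and chaining\<close>

lemma not_covered_prob_eq:
  "not_covered_prob V E v t = walk_sum v t (\<lambda>xs. of_bool (\<not> V \<subseteq> set xs))"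
  unfolding not_covered_prob_def walk_sum_def
  by (subst sum.inter_filter[OF finite_walks]) (auto intro!: sum.cong)

lemma not_covered_prob_nonneg: "not_covered_prob V E v t \<ge> 0"
  unfolding not_covered_prob_def by (intro sum_nonneg walk_prob_nonneg)

lemma not_covered_prob_le_one:
  assumes "v \<in> V"
  shows "not_covered_prob V E v t \<le> 1"
proof -
  have "not_covered_prob V E v t \<le> walk_sum v t (\<lambda>_. 1)"
    unfolding not_covered_prob_eq by (rule walk_sum_mono) simp
  then show ?thesis using walk_sum_one_le[OF assms] by (rule order_trans)
qed

text \<open>Markov property at time \<open>r\<close>: wherever the walk stands, \<open>s\<close>
  more steps cover everything with probability at least one half. The set \<open>U\<close> of
  vertices seen earlier makes the first-step induction go through.\<close>

lemma walk_sum_not_covered_halving: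
  assumes half: "\<And>w. w \<in> V \<Longrightarrow> not_covered_prob V E w s \<le> 1 / 2" and "v \<in> V"
  shows "walk_sum v (r + s) (\<lambda>xs. of_bool (\<not> V \<subseteq> U \<union> set xs))
    \<le> 1 / 2 * walk_sum v r (\<lambda>xs. of_bool (\<not> V \<subseteq> U \<union> set xs))"
  using \<open>v \<in> V\<close>
proof (induction r arbitrary: v U)
  case 0
  show ?case
  proof (cases "V \<subseteq> U \<union> {v}")
    case True
    have "walk_sum v s (\<lambda>xs. of_bool (\<not> V \<subseteq> U \<union> set xs)) \<le> walk_sum v s (\<lambda>_. 0)"
    proof (rule walk_sum_mono)
      fix xs assume "xs \<in> walks V E v s"
      then have "v \<in> set xs" by (auto simp: walks_def)
      then have "V \<subseteq> U \<union> set xs" using True by blast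
      then show "of_bool (\<not> V \<subseteq> U \<union> set xs) \<le> (0::real)" by simp
    qed
    moreover have "walk_sum v s (\<lambda>_. 0) = 0" by (simp add: walk_sum_def)
    ultimately show ?thesis using 0 True by (simp add: walk_sum_0)
  next
    case False
    have "walk_sum v s (\<lambda>xs. of_bool (\<not> V \<subseteq> U \<union> set xs)) \<le> not_covered_prob V E v s"
      unfolding not_covered_prob_eq
    proof (rule walk_sum_mono)
      show "of_bool (\<not> V \<subseteq> U \<union> set xs) \<le> (of_bool (\<not> V \<subseteq> set xs) :: real)" for xs
        by (simp add: of_bool_def) blast
    qed
    then show ?thesis using half[OF 0] False 0 by (simp add: walk_sum_0)
  qed
next
  case (Suc r)
  have "walk_sum v (Suc r + s) (\<lambda>xs. of_bool (\<not> V \<subseteq> U \<union> set xs))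
      = (\<Sum>y\<in>nbs v. walk_sum y (r + s) (\<lambda>xs. of_bool (\<not> V \<subseteq> insert v U \<union> set xs))) / deg v"
    using Suc.prems by (simp add: walk_sum_Suc)
  also have "\<dots> \<le> (\<Sum>y\<in>nbs v. 1 / 2 * walk_sum y r (\<lambda>xs. of_bool (\<not> V \<subseteq> insert v U \<union> set xs))) / deg v"
    using nbs_subset by (intro divide_right_mono sum_mono Suc.IH) (auto simp: deg_def)
  also have "\<dots> = 1 / 2 * walk_sum v (Suc r) (\<lambda>xs. of_bool (\<not> V \<subseteq> U \<union> set xs))"
    using Suc.prems by (simp add: walk_sum_Suc sum_divide_distrib sum_distrib_left)
  finally show ?case .
qed

text \<open>The first \<open>s\<close> tail probabilities add at most \<open>s\<close>, and shifting
  by \<open>s\<close> halves the rest, so a sum Q satisfies Q \<le> s + Q / 2. Partial sums are used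
  so that Q is known to be finite.\<close>

lemma exp_cover_time_le:
  assumes half: "\<And>w. w \<in> V \<Longrightarrow> not_covered_prob V E w s \<le> 1 / 2" and v: "v \<in> V"
  shows "exp_cover_time V E v \<le> ennreal (2 * real s)"
proof -
  define q where "q = not_covered_prob V E v"
  have q: "0 \<le> q t" "q t \<le> 1" for t
    using not_covered_prob_nonneg not_covered_prob_le_one v by (auto simp: q_def)
  have halving: "q (s + t) \<le> q t / 2" for t
    using walk_sum_not_covered_halving[OF half v, of t "{}"]
    by (simp add: q_def not_covered_prob_eq add.commute)
  have "sum q {..<N} \<le> 2 * real s" for N
  proof -
    have split: "sum q {..<s + N} = sum q {..<s} + (\<Sum>t<N. q (s + t))"
      by (induction N) auto
    have "sum q {..<N} \<le> sum q {..<s + N}"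
      using q by (intro sum_mono2) auto
    also have "\<dots> \<le> real s + (\<Sum>t<N. q t / 2)"
      unfolding split using q sum_bounded_above[of "{..<s}" q 1]
      by (intro add_mono sum_mono halving) auto
    finally show ?thesis by (simp add: sum_divide_distrib[symmetric])
  qed
  then have "(SUP N. \<Sum>t<N. ennreal (q t)) \<le> ennreal (2 * real s)"
    using q by (intro SUP_least) (simp add: sum_ennreal ennreal_leI del: ennreal_numeral)
  then show ?thesis
    unfolding exp_cover_time_def q_def[symmetric] by (simp add: suminf_eq_SUP)
qed

text \<open>Chaining: once the root has been visited often enough, the normalised visit counts can
  only fall below their thresholds at some level if the walk violates \<open>visits_deviation\<close> between
  a point of that level and its parent.\<close>

lemma not_covered_chaining:
  fixes M :: nat and d :: "nat \<Rightarrow> real"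
  assumes v: "v \<in> V" and "w \<in> V" "v \<noteq> w"
    and B: "\<And>i. B i \<subseteq> V" "B 0 = {v}" "B (Suc M) = V"
    and parent: "\<And>i u. \<lbrakk>i \<le> M; u \<in> B (Suc i)\<rbrakk> \<Longrightarrow> \<exists>p\<in>B i. R_eff V E p u \<le> \<rho> i"
    and d: "\<And>i. i \<le> M \<Longrightarrow> d i > 0"
  defines "D \<equiv> \<Sum>i\<le>M. d i"
  shows "not_covered_prob V E v t
    \<le> walk_sum v t (\<lambda>xs. of_bool (visits v t xs < (2 * D)\<^sup>2 * deg v))
      + (\<Sum>i\<le>M. real (card (B (Suc i))) * (2 * exp (- (d i)\<^sup>2 / \<rho> i)))"
proof -
  \<comment> \<open>Thresholds for the square roots, falling from 2 D at the root to D at the last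
    level. The reserve D ensures \<open>d i \<le> x (Suc i)\<close>, as
    \<open>visits_deviation\<close> requires, and forces a visit at the end.\<close>
  define x where "x i = D + (\<Sum>j\<in>{i..M}. d j)" for i
  have x0: "x 0 = 2 * D" by (simp add: x_def D_def atMost_atLeast0)
  have xM: "x (Suc M) = D" by (simp add: x_def)
  have xS: "x i = x (Suc i) + d i" if "i \<le> M" for i
    using that by (simp add: x_def sum.atLeast_Suc_atMost)
  have dD: "d i \<le> D" if "i \<le> M" for i
    unfolding D_def using that d by (intro member_le_sum) (auto intro: less_imp_le)
  have Dpos: "D > 0" using d[of 0] dD[of 0] by simp
  have xD: "x i \<ge> D" for i
    using sum_nonneg[of "{i..M}" d] d by (force simp: x_def intro: less_imp_le)
  define par where "par i u = (SOME p. p \<in> B i \<and> R_eff V E p u \<le> \<rho> i)" for i u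
  have par: "par i u \<in> B i" "R_eff V E (par i u) u \<le> \<rho> i" if "i \<le> M" "u \<in> B (Suc i)" for i u
    using someI_ex[of "\<lambda>p. p \<in> B i \<and> R_eff V E p u \<le> \<rho> i"] parent[OF that]
    unfolding par_def by blast+
  define bad where "bad i u xs \<longleftrightarrow> (x (Suc i) + d i)\<^sup>2 * deg (par i u) \<le> visits (par i u) t xs \<and>
      visits u t xs < (x (Suc i))\<^sup>2 * deg u" for i u xs
  have finB: "finite (B i)" for i using B(1) finite_V finite_subset by blast
  have "not_covered_prob V E v t \<le> walk_sum v t (\<lambda>xs. of_bool (visits v t xs < (2 * D)\<^sup>2 * deg v)
      + (\<Sum>i\<le>M. \<Sum>u\<in>B (Suc i). of_bool (bad i u xs)))"
    unfolding not_covered_prob_eq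
  proof (rule walk_sum_mono)
    fix xs assume xs: "xs \<in> walks V E v t"
    have nonneg: "(\<Sum>i\<le>M. \<Sum>u\<in>B (Suc i). of_bool (bad i u xs)) \<ge> (0::real)"
      by (intro sum_nonneg) auto
    consider "visits v t xs < (2 * D)\<^sup>2 * deg v" | i u where "i \<le> M" "u \<in> B (Suc i)" "bad i u xs"
      | "\<not> visits v t xs < (2 * D)\<^sup>2 * deg v" "\<And>i u. \<lbrakk>i \<le> M; u \<in> B (Suc i)\<rbrakk> \<Longrightarrow> \<not> bad i u xs"
      by blast
    then show "of_bool (\<not> V \<subseteq> set xs) \<le> of_bool (visits v t xs < (2 * D)\<^sup>2 * deg v)
      + (\<Sum>i\<le>M. \<Sum>u\<in>B (Suc i). of_bool (bad i u xs) :: real)"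
    proof cases
      case 1
      then show ?thesis using nonneg by (simp add: add_increasing2)
    next
      case 2
      have "(1::real) = of_bool (bad i u xs)" using 2 by simp
      also have "\<dots> \<le> (\<Sum>u\<in>B (Suc i). of_bool (bad i u xs))"
        using 2 finB by (intro member_le_sum) auto
      also have "\<dots> \<le> (\<Sum>i\<le>M. \<Sum>u\<in>B (Suc i). of_bool (bad i u xs))"
        using 2 by (intro member_le_sum[of i]) (auto intro: sum_nonneg)
      finally show ?thesis
        by (intro order_trans[OF _ add_increasing[OF _ order_refl]]) (auto simp: of_bool_def)
    next
      case 3
      have good: "\<forall>u\<in>B i. (x i)\<^sup>2 * deg u \<le> visits u t xs" if "i \<le> Suc M" for i
        using that
      proof (induction i)
        case 0
        then show ?case using 3(1) B(2) x0 by simp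
      next
        case (Suc i)
        then have "i \<le> M" by simp
        show ?case
        proof
          fix u assume u: "u \<in> B (Suc i)"
          have "(x i)\<^sup>2 * deg (par i u) \<le> visits (par i u) t xs"
            using Suc par[OF \<open>i \<le> M\<close> u] by simp
          then show "(x (Suc i))\<^sup>2 * deg u \<le> visits u t xs"
            using 3(2)[OF \<open>i \<le> M\<close> u] xS[OF \<open>i \<le> M\<close>] by (simp add: bad_def not_less)
        qed
      qed
      have "V \<subseteq> set xs"
      proof
        fix u assume u: "u \<in> V"
        have "deg u > 0" using deg_pos u assms by metis
        then have "0 < D\<^sup>2 * deg u" using Dpos by simp
        also have "\<dots> \<le> visits u t xs" using good[of "Suc M"] xM B(3) u by simp
        finally have "\<exists>j<t. xs ! j = u"
          by (rule contrapos_pp) (auto simp: visits_def intro!: sum.neutral)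
        then show "u \<in> set xs" using xs by (auto simp: walks_def)
      qed
      then show ?thesis using nonneg by (simp add: add_nonneg_nonneg)
    qed
  qed
  also have "\<dots> = walk_sum v t (\<lambda>xs. of_bool (visits v t xs < (2 * D)\<^sup>2 * deg v))
      + (\<Sum>i\<le>M. \<Sum>u\<in>B (Suc i). walk_sum v t (\<lambda>xs. of_bool (bad i u xs)))"
    by (simp only: walk_sum_add walk_sum_sum)
  also have "(\<Sum>i\<le>M. \<Sum>u\<in>B (Suc i). walk_sum v t (\<lambda>xs. of_bool (bad i u xs)))
      \<le> (\<Sum>i\<le>M. real (card (B (Suc i))) * (2 * exp (- (d i)\<^sup>2 / \<rho> i)))"
  proof (intro sum_mono sum_bounded_above)
    fix i u assume "i \<in> {..M}" and u: "u \<in> B (Suc i)"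
    then have i: "i \<le> M" by simp
    show "walk_sum v t (\<lambda>xs. of_bool (bad i u xs)) \<le> 2 * exp (- (d i)\<^sup>2 / \<rho> i)"
      unfolding bad_def
    proof (rule visits_deviation)
      show "d i \<le> x (Suc i)" using dD[OF i] xD by (rule order_trans)
      show "0 < x (Suc i)" using Dpos xD by (rule less_le_trans)
    qed (use par[OF i u] B(1) u v d[OF i] in \<open>auto intro: less_imp_le\<close>)
  qed
  finally show ?thesis by simp
qed

section \<open>Optimal covers and the parameters of the chain\<close>

lemma cover_num_attained:
  obtains A where "A \<subseteq> V" "card A = cover_num V E i"
    "\<And>u. u \<in> V \<Longrightarrow> \<exists>p\<in>A. R_eff V E p u \<le> eff_diam V E / 2 ^ i"
proof -
  define S where "S = {card A | A. A \<subseteq> V \<and> V \<subseteq> (\<Union>v\<in>A. B_eff V E v (eff_diam V E / 2 ^ i))}"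
  have "S \<subseteq> {..card V}" using card_mono[OF finite_V] by (auto simp: S_def)
  then have "finite S" by (rule finite_subset) simp
  have self: "R_eff V E u u = 0" for u by (simp add: R_eff_def)
  \<comment> \<open>\<open>V\<close> covers itself, so the minimum is over a nonempty set.\<close>
  have "u \<in> B_eff V E u (eff_diam V E / 2 ^ i)" if "u \<in> V" for u
    using R_eff_le_diam[OF that that] that by (simp add: B_eff_def self)
  then have "card V \<in> S" by (auto simp: S_def)
  then have "Min S \<in> S" using \<open>finite S\<close> by (intro Min_in) auto
  then have "\<exists>A. cover_num V E i = card A \<and> A \<subseteq> V \<and> V \<subseteq> (\<Union>v\<in>A. B_eff V E v (eff_diam V E / 2 ^ i))"
    unfolding cover_num_def S_def[symmetric] by (simp add: S_def)
  then obtain A where A: "cover_num V E i = card A" "A \<subseteq> V"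
      "V \<subseteq> (\<Union>v\<in>A. B_eff V E v (eff_diam V E / 2 ^ i))" by metis
  show thesis
  proof (rule that[of A])
    show "\<exists>p\<in>A. R_eff V E p u \<le> eff_diam V E / 2 ^ i" if "u \<in> V" for u
      using A(3) that by (auto simp: B_eff_def)
  qed (use A in auto)
qed

lemma cover_num_pos:
  assumes "V \<noteq> {}"
  shows "cover_num V E i \<ge> 1"
proof -
  obtain A where A: "A \<subseteq> V" "card A = cover_num V E i"
    "\<And>u. u \<in> V \<Longrightarrow> \<exists>p\<in>A. R_eff V E p u \<le> eff_diam V E / 2 ^ i"
    using cover_num_attained[of i] by metis
  have "A \<noteq> {}" "finite A" using A assms finite_V finite_subset by blast+
  then have "card A > 0" by (simp add: card_gt_0_iff)
  then show ?thesis using A(2) by simp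
qed

text \<open>A ball of radius R/4 has diameter at most R/2, so one cannot contain two points at
  distance R. At level 1, with radius R/2, a single ball may suffice.\<close>

lemma cover_num_2_ge:
  assumes "v \<in> V" "w \<in> V" "v \<noteq> w"
  shows "cover_num V E 2 \<ge> 2"
proof (rule ccontr)
  assume "\<not> cover_num V E 2 \<ge> 2"
  then have one: "cover_num V E 2 = 1" using cover_num_pos[of 2] assms by fastforce
  obtain A where A: "A \<subseteq> V" "card A = cover_num V E 2"
    "\<And>u. u \<in> V \<Longrightarrow> \<exists>p\<in>A. R_eff V E p u \<le> eff_diam V E / 2 ^ 2"
    using cover_num_attained[of 2] by metis
  obtain c where "A = {c}" using A(2) one by (auto simp: card_1_singleton_iff)
  then have c: "c \<in> V" "\<And>u. u \<in> V \<Longrightarrow> R_eff V E c u \<le> eff_diam V E / 4" using A by auto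
  obtain x y where xy: "x \<in> V" "y \<in> V" "eff_diam V E = R_eff V E x y"
    using eff_diam_attained assms by blast
  have "eff_diam V E > 0" using R_eff_pos[OF assms] R_eff_le_diam[of v w] assms by linarith
  moreover have "eff_diam V E \<le> R_eff V E c x + R_eff V E c y"
    using R_eff_triangle[of x c y] R_eff_commute[of x c] xy c(1) by simp
  ultimately show False using c(2)[OF xy(1)] c(2)[OF xy(2)] by simp
qed

text \<open>Rounding up gives \<open>2 ^ levels\<close> at least ln n once n is at least 2; the
  lower bound 2 keeps level 2, where at least two balls are needed, inside the sum even for small
  graphs.\<close>

definition levels :: nat where
  "levels = nat (max 2 \<lceil>log 2 (ln (real (card V)))\<rceil>)"

definition chain_size :: "nat \<Rightarrow> real" where
  "chain_size i = real (if i \<le> levels then cover_num V E i else card V)"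

text \<open>Solves size * 2 * exp (- step^2 / radius) = \<open>(1 / 8) * (1 / 2) ^ i\<close>, with
  the radius of level \<open>i\<close> and the size of level \<open>Suc i\<close>; the failure
  probabilities then add up to at most 1/4.\<close>

definition chain_step :: "nat \<Rightarrow> real" where
  "chain_step i = sqrt (eff_diam V E / 2 ^ i * (ln (chain_size (Suc i)) + (real i + 4) * ln 2))"

definition chain_total :: real where
  "chain_total = (\<Sum>i\<le>levels. chain_step i)"

lemma chain_size_ge_one: "V \<noteq> {} \<Longrightarrow> chain_size i \<ge> 1"
  using cover_num_pos[of i] finite_V by (simp add: chain_size_def Suc_le_eq card_gt_0_iff)

lemma not_covered_prob_le_half:
  assumes v: "v \<in> V" and w: "w \<in> V" "v \<noteq> w"
    and t: "real t \<ge> 4 * real (card E) * (8 * chain_total\<^sup>2 + 2 * eff_diam V E)"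
  shows "not_covered_prob V E v t \<le> 1 / 2"
proof -
  define R where "R = eff_diam V E"
  define m where "m = real (card E)"
  define D where "D = chain_total"
  have Rpos: "R > 0" using R_eff_pos[OF v w] R_eff_le_diam[OF v w(1)] by (simp add: R_def)
  have "m * R_eff V E v w \<ge> 1" using card_E_mult_R_eff_ge[OF v w] by (simp add: m_def)
  then have mpos: "m > 0" by (cases "card E = 0") (auto simp: m_def)
  have size: "chain_size i \<ge> 1" for i using chain_size_ge_one v by blast
  have weight: "ln (chain_size (Suc i)) + (real i + 4) * ln 2 > 0" for i
    using size[of "Suc i"] by (intro add_nonneg_pos mult_pos_pos) auto
  define A where "A i = (SOME A. A \<subseteq> V \<and> card A = cover_num V E i \<and>
    (\<forall>u\<in>V. \<exists>p\<in>A. R_eff V E p u \<le> R / 2 ^ i))" for i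
  have A: "A i \<subseteq> V \<and> card (A i) = cover_num V E i \<and>
    (\<forall>u\<in>V. \<exists>p\<in>A i. R_eff V E p u \<le> R / 2 ^ i)" for i
    unfolding A_def R_def by (rule someI_ex) (metis cover_num_attained)
  \<comment> \<open>The root alone serves as level 0, since everything lies within R of it; after
    the last cover the chain jumps to all of \<open>V\<close>.\<close>
  define B where "B i = (if i = 0 then {v} else if i \<le> levels then A i else V)" for i
  have "not_covered_prob V E v t
    \<le> walk_sum v t (\<lambda>xs. of_bool (visits v t xs < (2 * D)\<^sup>2 * deg v))
      + (\<Sum>i\<le>levels. real (card (B (Suc i))) * (2 * exp (- (chain_step i)\<^sup>2 / (R / 2 ^ i))))"
    unfolding D_def chain_total_def
  proof (rule not_covered_chaining[OF v w])
    show "B i \<subseteq> V" for i using A v by (simp add: B_def)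
    show "B 0 = {v}" "B (Suc levels) = V" by (simp_all add: B_def)
    show "chain_step i > 0" for i
      unfolding chain_step_def R_def[symmetric] using Rpos weight[of i] by simp
    fix i u assume i: "i \<le> levels" and "u \<in> B (Suc i)"
    then have u: "u \<in> V" using A by (auto simp: B_def split: if_splits)
    show "\<exists>p\<in>B i. R_eff V E p u \<le> R / 2 ^ i"
    proof (cases "i = 0")
      case True
      then show ?thesis using R_eff_le_diam[OF v u] by (simp add: B_def R_def)
    next
      case False
      then show ?thesis using A u i by (simp add: B_def)
    qed
  qed
  also have "walk_sum v t (\<lambda>xs. of_bool (visits v t xs < (2 * D)\<^sup>2 * deg v)) \<le> 1 / 4"
  proof -
    \<comment> \<open>The hypothesis on \<open>t\<close> is chosen to leave exponent at most -2 in
      \<open>visits_root\<close> with X = 2 D.\<close>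
    have "4 * m * R * (8 * D\<^sup>2 / R + 2) \<le> real t"
      using t Rpos by (simp add: m_def R_def D_def algebra_simps)
    then have "8 * D\<^sup>2 / R + 2 \<le> real t / (4 * m * R)"
      using Rpos mpos by (simp add: pos_le_divide_eq mult.commute)
    then have "exp (2 * (2 * D)\<^sup>2 / R - real t / (4 * m * R)) \<le> exp (- 2)"
      by (simp add: power_mult_distrib)
    also have "\<dots> \<le> 1 / 4"
    proof -
      have "(2::real) * 2 \<le> exp 1 * exp 1" using exp_ge_add_one_self[of "1::real"] by (intro mult_mono) auto
      also have "\<dots> = exp 2" by (simp flip: exp_add)
      finally show ?thesis by (simp add: exp_minus divide_simps)
    qed
    finally show ?thesis
      using visits_root[OF v w, of t "2 * D"] by (simp add: R_def m_def)
  qed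
  also have "(\<Sum>i\<le>levels. real (card (B (Suc i))) * (2 * exp (- (chain_step i)\<^sup>2 / (R / 2 ^ i)))) \<le> 1 / 4"
  proof -
    have "real (card (B (Suc i))) * (2 * exp (- (chain_step i)\<^sup>2 / (R / 2 ^ i))) = (1 / 8) * (1 / 2) ^ i" for i
    proof -
      have "(chain_step i)\<^sup>2 = R / 2 ^ i * (ln (chain_size (Suc i)) + (real i + 4) * ln 2)"
        unfolding chain_step_def R_def[symmetric]
        using Rpos weight[of i] by (intro real_sqrt_pow2) simp
      then have e: "- (chain_step i)\<^sup>2 / (R / 2 ^ i) = - (ln (chain_size (Suc i)) + real (i + 4) * ln 2)"
        using Rpos by simp
      have "exp (real (i + 4) * ln 2) = (2::real) ^ (i + 4)"
        by (subst exp_of_nat_mult) simp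
      then have "exp (- (chain_step i)\<^sup>2 / (R / 2 ^ i)) = inverse (chain_size (Suc i) * 2 ^ (i + 4))"
        using size[of "Suc i"] unfolding e exp_minus exp_add by simp
      moreover have "real (card (B (Suc i))) = chain_size (Suc i)"
        using A by (simp add: B_def chain_size_def)
      ultimately show ?thesis
        using size[of "Suc i"] by (simp add: power_add power_divide field_simps)
    qed
    then have "(\<Sum>i\<le>levels. real (card (B (Suc i))) * (2 * exp (- (chain_step i)\<^sup>2 / (R / 2 ^ i))))
        = 1 / 8 * (\<Sum>i\<le>levels. (1 / 2) ^ i)"
      by (simp only: sum_distrib_left)
    then show ?thesis using sum_half_powers[of levels] by simp
  qed
  finally show ?thesis by simp
qed

text \<open>Subadditivity of the square root splits each step into an entropy term and a geometric
  weight. The entropy terms below the last level form the sum \<open>S\<close>; all else is a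
  bounded multiple of sqrt R, absorbed through \<open>S \<ge> 1 / 3\<close>.\<close>

lemma chain_total_le:
  assumes v: "v \<in> V" and w: "w \<in> V" "v \<noteq> w"
  defines "S \<equiv> \<Sum>i = 1..levels. sqrt (alpha V E i)"
  shows "chain_total \<le> 35 * sqrt (eff_diam V E) * S" "S \<ge> 1 / 3"
proof -
  define R where "R = eff_diam V E"
  have Rnn: "R \<ge> 0" using R_eff_pos[OF v w] R_eff_le_diam[OF v w(1)] by (simp add: R_def)
  have size: "chain_size i \<ge> 1" for i using chain_size_ge_one v by blast
  have "V \<noteq> {}" using v by auto
  have alpha_nonneg: "alpha V E i \<ge> 0" for i
    using cover_num_pos[OF \<open>V \<noteq> {}\<close>, of i] by (simp add: alpha_def)
  have "2 \<in> {1..levels}" by (simp add: levels_def)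
  then have "sqrt (alpha V E 2) \<le> S"
    unfolding S_def using alpha_nonneg by (intro member_le_sum) auto
  moreover have "1 / 3 \<le> sqrt (alpha V E 2)"
  proof (rule real_le_rsqrt)
    have "ln (1 / 2 :: real) \<le> 1 / 2 - 1" by (rule ln_le_minus_one) simp
    then have "1 / 2 \<le> ln (2::real)" by (simp add: ln_div)
    also have "\<dots> \<le> ln (real (cover_num V E 2))" using cover_num_2_ge[OF v w] by simp
    finally show "(1 / 3)\<^sup>2 \<le> alpha V E 2" by (simp add: alpha_def power2_eq_square)
  qed
  ultimately show S: "S \<ge> 1 / 3" by simp
  define c where "c i = sqrt (ln (chain_size (Suc i)) / 2 ^ i)" for i
  have step: "chain_step i \<le> sqrt R * (c i + 2 * (4 / 5) ^ i)" for i
  proof -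
    have "chain_step i = sqrt R * sqrt (ln (chain_size (Suc i)) / 2 ^ i + (real i + 4) * ln 2 / 2 ^ i)"
      unfolding chain_step_def R_def[symmetric] real_sqrt_mult[symmetric]
      by (simp add: add_divide_distrib distrib_left)
    also have "\<dots> \<le> sqrt R * (c i + sqrt ((real i + 4) * ln 2 / 2 ^ i))"
      unfolding c_def using size[of "Suc i"] Rnn by (intro mult_left_mono sqrt_add_le_add_sqrt) auto
    also have "\<dots> \<le> sqrt R * (c i + 2 * (4 / 5) ^ i)"
      using sqrt_level_weight_le[of i] Rnn by (intro mult_left_mono) auto
    finally show ?thesis .
  qed
  \<comment> \<open>Step \<open>i\<close> pairs radius \<open>2 ^ i\<close> with the next cover,
    whose \<open>alpha\<close> divides by twice that; hence sqrt 2.\<close>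
  have c: "c i = sqrt 2 * sqrt (alpha V E (Suc i))" if "i < levels" for i
    using that by (simp add: c_def alpha_def chain_size_def flip: real_sqrt_mult)
  have last: "c levels \<le> 1"
  proof -
    have "card {v, w} \<le> card V" using v w finite_V by (intro card_mono) auto
    then have n: "card V \<ge> 2" using w by simp
    have "ln (real (card V)) = 2 powr log 2 (ln (real (card V)))" using n by simp
    also have "\<dots> \<le> 2 powr real levels"
      by (intro powr_mono) (auto simp: levels_def, linarith)
    also have "\<dots> = 2 ^ levels" by (simp add: powr_realpow)
    finally show ?thesis by (simp add: c_def chain_size_def divide_le_eq)
  qed
  have "chain_total \<le> (\<Sum>i\<le>levels. sqrt R * (c i + 2 * (4 / 5) ^ i))"
    unfolding chain_total_def by (intro sum_mono step)
  also have "\<dots> = sqrt R * ((\<Sum>i<levels. c i) + c levels + 2 * (\<Sum>i\<le>levels. (4 / 5) ^ i))"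
    by (simp add: sum_distrib_left[symmetric] sum.distrib flip: lessThan_Suc_atMost)
  also have "(\<Sum>i<levels. c i) = sqrt 2 * S"
    by (simp add: c S_def sum.atLeast1_atMost_eq sum_distrib_left)
  also have "sqrt R * (sqrt 2 * S + c levels + 2 * (\<Sum>i\<le>levels. (4 / 5) ^ i)) \<le> sqrt R * (35 * S)"
  proof (rule mult_left_mono)
    have "sqrt 2 * S \<le> 2 * S" using S real_le_lsqrt[of 2 2] by (intro mult_right_mono) auto
    \<comment> \<open>The constants add up to at most 1 + 10 = 11, hence to 33 S, and 2 S comes from
      the entropy.\<close>
    then show "sqrt 2 * S + c levels + 2 * (\<Sum>i\<le>levels. (4 / 5) ^ i) \<le> 35 * S"
      using last sum_four_fifths_powers[of levels] S by linarith
  qed (use Rnn in simp)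
  finally show "chain_total \<le> 35 * sqrt (eff_diam V E) * S" by (simp add: R_def mult.left_commute)
qed

lemma exp_cover_time_bound:
  assumes v: "v \<in> V"
  shows "exp_cover_time V E v \<le> ennreal (80000 * (\<Sum>i = 1..levels. sqrt (alpha V E i))\<^sup>2 *
    eff_diam V E * real (card E))"
proof (cases "V = {v}")
  case True
  have "v \<in> set xs" if "xs \<in> walks V E v t" for xs t using that by (auto simp: walks_def)
  then have "{xs \<in> walks V E v t. \<not> V \<subseteq> set xs} = {}" for t using True by auto
  then have "exp_cover_time V E v = 0" by (simp only: exp_cover_time_def not_covered_prob_def sum.empty) simp
  then show ?thesis by simp
next
  case False
  then obtain w where w: "w \<in> V" "v \<noteq> w" using v by blast
  define R where "R = eff_diam V E"
  define m where "m = real (card E)"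
  define D where "D = chain_total"
  define S where "S = (\<Sum>i = 1..levels. sqrt (alpha V E i))"
  define T where "T = 4 * m * (8 * D\<^sup>2 + 2 * R)"
  have R: "R_eff V E v w \<le> R" "R_eff V E v w > 0"
    using R_eff_le_diam R_eff_pos v w by (auto simp: R_def)
  have "1 \<le> m * R_eff V E v w" using card_E_mult_R_eff_ge[OF v w] by (simp add: m_def)
  also have "\<dots> \<le> m * R" using R by (intro mult_left_mono) (auto simp: m_def)
  finally have mR: "1 \<le> m * R" .
  have "R \<ge> 0" "m \<ge> 0" using R by (auto simp: m_def)
  then have T: "T \<ge> 0" by (simp add: T_def)
  have "exp_cover_time V E v \<le> ennreal (2 * real (nat \<lceil>T\<rceil>))"
  proof (rule exp_cover_time_le[OF _ v])
    fix u assume u: "u \<in> V"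
    have "\<exists>u'\<in>V. u \<noteq> u'" using v w by metis
    moreover have "real (nat \<lceil>T\<rceil>) \<ge> T" by (rule real_nat_ceiling_ge)
    ultimately show "not_covered_prob V E u (nat \<lceil>T\<rceil>) \<le> 1 / 2"
      using not_covered_prob_le_half[OF u, of _ "nat \<lceil>T\<rceil>"] by (auto simp: T_def m_def D_def R_def)
  qed
  also have "2 * real (nat \<lceil>T\<rceil>) \<le> 80000 * S\<^sup>2 * R * m"
  proof -
    have S: "S \<ge> 1 / 3" and DS: "D \<le> 35 * sqrt R * S"
      using chain_total_le[OF v w] by (simp_all add: S_def D_def R_def)
    have "D \<ge> 0"
      unfolding D_def chain_total_def chain_step_def R_def[symmetric]
      using \<open>R \<ge> 0\<close> v
      by (intro sum_nonneg real_sqrt_ge_zero mult_nonneg_nonneg add_nonneg_nonneg ln_ge_zero chain_size_ge_one) auto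
    then have "D\<^sup>2 \<le> (35 * sqrt R * S)\<^sup>2" using DS by (intro power_mono) auto
    then have D: "D\<^sup>2 \<le> 1225 * (R * S\<^sup>2)"
      using \<open>R \<ge> 0\<close> by (simp add: power_mult_distrib)
    have "(1 / 3)\<^sup>2 \<le> S\<^sup>2" using S by (intro power_mono) auto
    then have one: "1 \<le> 9 * S\<^sup>2" by (simp add: power2_eq_square)
    have "real (nat \<lceil>T\<rceil>) \<le> T + 1" using T by linarith
    then have "2 * real (nat \<lceil>T\<rceil>) \<le> 64 * (m * D\<^sup>2) + 16 * (m * R) * 1 + 2 * 1 * 1"
      by (simp add: T_def algebra_simps)
    \<comment> \<open>The diameter term and the rounding error are multiplied by 9 S^2 and, for the
      rounding error, also by m R, both at least 1; 64 * 1225 + 144 + 18 = 78562.\<close>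
    also have "\<dots> \<le> 64 * (m * (1225 * (R * S\<^sup>2))) + 16 * (m * R) * (9 * S\<^sup>2) + 2 * (m * R) * (9 * S\<^sup>2)"
      using D one mR \<open>m \<ge> 0\<close> \<open>R \<ge> 0\<close> by (intro add_mono mult_mono) auto
    also have "\<dots> = 78562 * (m * R * S\<^sup>2)" by (simp add: algebra_simps)
    also have "\<dots> \<le> 80000 * (m * R * S\<^sup>2)" using mR by (intro mult_right_mono) auto
    finally show ?thesis by (simp add: algebra_simps)
  qed
  finally show ?thesis by (simp add: S_def R_def m_def ennreal_leI)
qed

end

theorem theorem1p1:
  "\<exists>C::real. C > 0 \<and>
     (\<forall>(V::nat set) (E::nat set set).
        simple_graph V E \<longrightarrow> V \<noteq> {} \<longrightarrow>
        (\<forall>x\<in>V. \<forall>y\<in>V. x \<noteq> y \<longrightarrow> eff_cond V E x y > 0) \<longrightarrow>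
        t_cov V E \<le> ennreal (C *
          (\<Sum>i = 1..nat (max 2 \<lceil>log 2 (ln (real (card V)))\<rceil>). sqrt (alpha V E i))^2 *
          eff_diam V E * real (card E)))"
proof (intro exI[of _ 80000] conjI allI impI)
  fix V :: "nat set" and E :: "nat set set"
  assume "simple_graph V E" "V \<noteq> {}"
    and "\<forall>x\<in>V. \<forall>y\<in>V. x \<noteq> y \<longrightarrow> eff_cond V E x y > 0"
  then interpret network V E by unfold_locales auto
  show "t_cov V E \<le> ennreal (80000 *
      (\<Sum>i = 1..nat (max 2 \<lceil>log 2 (ln (real (card V)))\<rceil>). sqrt (alpha V E i))^2 *
      eff_diam V E * real (card E))"
    unfolding t_cov_def levels_def[symmetric]
    using finite_V \<open>V \<noteq> {}\<close> exp_cover_time_bound by (intro Max.boundedI) auto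
qed simp

end
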